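(* For any finite group $G$, there exists a directed inverse system of finite perfect groups with surjective transition homomorphisms, whose projective (inverse) limit $P$ admits a surjective homomorphism of abstract groups $P\to G$.
   Context: A group $P$ is perfect if $P=[P,P]$. Quotients are abstract quotients: the homomorphism onto $G$ is not required to be continuous. *)

theory Defs
  imports "HOL-Algebra.Algebra"
begin

definition perfect_group :: "('a, 'b) monoid_scheme \<Rightarrow> bool"
  where "perfect_group G \<longleftrightarrow> group G \<and> derived G (carrier G) = carrier G"

text \<open>A directed set is a nonempty partially ordered set in which any two elements have a common
  upper bound; \<open>(i, j) \<in> r\<close> is read as \<open>i \<le> j\<close>.\<close>

definition directed_set :: "'i set \<Rightarrow> 'i rel \<Rightarrow> bool"
  where "directed_set I r \<longleftrightarrow>
    partial_order_on I r \<and> I \<noteq> {} \<and> (\<forall>i\<in>I. \<forall>j\<in>I. \<exists>k\<in>I. (i, k) \<in> r \<and> (j, k) \<in> r)"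

text \<open>For \<open>i \<le> j\<close> the transition homomorphism \<open>f i j\<close> goes from \<open>H j\<close> to \<open>H i\<close>.\<close>

locale group_inverse_system =
  fixes I :: "'i set" and r :: "'i rel"
    and H :: "'i \<Rightarrow> ('a, 'b) monoid_scheme" and f :: "'i \<Rightarrow> 'i \<Rightarrow> 'a \<Rightarrow> 'a"
  assumes directed: "directed_set I r"
    and groups: "i \<in> I \<Longrightarrow> group (H i)"
    and transition_hom: "(i, j) \<in> r \<Longrightarrow> f i j \<in> hom (H j) (H i)"
    and transition_id: "\<lbrakk>i \<in> I; x \<in> carrier (H i)\<rbrakk> \<Longrightarrow> f i i x = x"
    and transition_comp:
      "\<lbrakk>(i, j) \<in> r; (j, k) \<in> r; x \<in> carrier (H k)\<rbrakk> \<Longrightarrow> f i j (f j k x) = f i k x"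

definition inverse_limit ::
    "'i set \<Rightarrow> 'i rel \<Rightarrow> ('i \<Rightarrow> ('a, 'b) monoid_scheme) \<Rightarrow> ('i \<Rightarrow> 'i \<Rightarrow> 'a \<Rightarrow> 'a) \<Rightarrow> ('i \<Rightarrow> 'a) monoid"
  where "inverse_limit I r H f = (product_group I H)
    \<lparr>carrier := {x \<in> carrier (product_group I H). \<forall>(i, j)\<in>r. f i j (x j) = x i}\<rparr>"

lemma (in group_inverse_system) group_inverse_limit: "group (inverse_limit I r H f)"
proof -
  interpret P: group "product_group I H"
    by (simp add: groups)
  have rI: "i \<in> I \<and> j \<in> I" if "(i, j) \<in> r" for i j
    using directed that by (auto simp: directed_set_def dest: partial_order_onD)
  have hom: "group_hom (H j) (H i) (f i j)" if "(i, j) \<in> r" for i j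
    using that rI groups transition_hom by (simp add: group_hom_def group_hom_axioms_def)
  have "subgroup {x \<in> carrier (product_group I H). \<forall>(i, j)\<in>r. f i j (x j) = x i} (product_group I H)"
  proof (rule P.subgroupI)
    show "{x \<in> carrier (product_group I H). \<forall>(i, j)\<in>r. f i j (x j) = x i} \<noteq> {}"
    proof -
      have "f i j (\<one>\<^bsub>product_group I H\<^esub> j) = \<one>\<^bsub>product_group I H\<^esub> i" if "(i, j) \<in> r" for i j
        using rI[OF that] group_hom.hom_one[OF hom[OF that]] by simp
      then show ?thesis
        using P.one_closed by blast
    qed
  next
    fix x
    assume x: "x \<in> {x \<in> carrier (product_group I H). \<forall>(i, j)\<in>r. f i j (x j) = x i}"
    have "f i j ((inv\<^bsub>product_group I H\<^esub> x) j) = (inv\<^bsub>product_group I H\<^esub> x) i"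
      if "(i, j) \<in> r" for i j
    proof -
      have "x j \<in> carrier (H j)" "f i j (x j) = x i" "x \<in> (\<Pi>\<^sub>E i\<in>I. carrier (H i))"
        using x that rI[OF that] by (auto simp: PiE_iff)
      then show ?thesis
        using rI[OF that] group_hom.hom_inv[OF hom[OF that]] groups by simp
    qed
    then show "inv\<^bsub>product_group I H\<^esub> x
        \<in> {x \<in> carrier (product_group I H). \<forall>(i, j)\<in>r. f i j (x j) = x i}"
      using x P.inv_closed by blast
  next
    fix x y
    assume x: "x \<in> {x \<in> carrier (product_group I H). \<forall>(i, j)\<in>r. f i j (x j) = x i}"
      and y: "y \<in> {x \<in> carrier (product_group I H). \<forall>(i, j)\<in>r. f i j (x j) = x i}"
    have "f i j ((x \<otimes>\<^bsub>product_group I H\<^esub> y) j) = (x \<otimes>\<^bsub>product_group I H\<^esub> y) i"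
      if "(i, j) \<in> r" for i j
    proof -
      have "x j \<in> carrier (H j)" "y j \<in> carrier (H j)"
        using x y rI[OF that] by (auto simp: PiE_iff)
      moreover have "f i j (x j) = x i" "f i j (y j) = y i"
        using x y that by auto
      ultimately show ?thesis
        using rI[OF that] hom_mult[OF transition_hom[OF that]] by simp
    qed
    then show "x \<otimes>\<^bsub>product_group I H\<^esub> y
        \<in> {x \<in> carrier (product_group I H). \<forall>(i, j)\<in>r. f i j (x j) = x i}"
      using x y P.m_closed by blast
  qed auto
  then show ?thesis
    unfolding inverse_limit_def by (rule P.subgroup_imp_group)
qed

end

theory Submission
  imports Defs
begin

text \<open>Fix a nontrivial finite perfect group \<open>S\<close>; here it is the alternating group of degree five. The
  group \<open>S \<times> S\<close> acts on the set \<open>S\<close> by left and right multiplication. Hence the power of \<open>S\<close> over the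
  natural numbers acts on the triples \<open>(i, j, s)\<close> through its coordinates \<open>i\<close> and \<open>j\<close>, and \<open>q\<close> fixes
  \<open>(i, j, \<one>)\<close> exactly when \<open>q i = q j\<close>. Two facts about this action drive the proof.

  \<^item> Locally it has fixed points. Given finitely many \<open>q\<close>, the pigeonhole principle yields \<open>i < j\<close> with
    \<open>q i = q j\<close> for all of them. By compactness there is an ultrafilter on pairs along which every
    single \<open>q\<close> satisfies \<open>q i = q j\<close> (\<open>exists_coincidence_ultrafilter\<close>).

  \<^item> Globally it has none if \<open>i \<noteq> j\<close>: the element that is \<open>t \<noteq> \<one>\<close> at \<open>i\<close> and trivial elsewhere moves
    \<open>(i, j, \<one>)\<close> to another point.

  Let \<open>W\<close> be the permutational wreath product of \<open>G\<close> with the power of \<open>S\<close>. Its elements are pairs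
  \<open>(f, q)\<close>, where \<open>f\<close> assigns elements of \<open>G\<close> to triples. By the first fact,
  \<open>(f, q) \<mapsto> lim f (i, j, \<one>)\<close> along the ultrafilter is multiplicative, although evaluation at a
  single \<open>(i, j, \<one>)\<close> with \<open>i < j\<close> is not, unless \<open>G\<close> is trivial. By the second fact, for every \<open>a\<close>
  in \<open>G\<close> the function with value \<open>a\<close> at all \<open>(i, j, \<one>)\<close>, \<open>i < j\<close>, and a compensating value \<open>a\<inverse>\<close> at
  all \<open>(i, j, t)\<close>, \<open>i < j\<close>, is, on finitely many
  coordinates, a product of commutators \<open>[d, c]\<close> with \<open>c\<close> in a copy of \<open>S\<close> (\<open>marker_mem\<close>). So it lies,
  on finitely many coordinates, in the subgroup generated by all homomorphic images of \<open>S\<close> in \<open>W\<close>,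
  and that subgroup is perfect (\<open>generated_by_images_perfect\<close>).

  The inverse system consists of the restrictions of this perfect subgroup to the finite sets of
  coordinates. They are finite and perfect, and the transition maps are restrictions again, so
  they are surjective. The ultralimit is defined on the inverse limit and maps onto \<open>G\<close>, since its
  value on the element described above is \<open>a\<close>. That element is a product of commutators on every
  level, but if \<open>a\<close> is not in the derived subgroup of \<open>G\<close>, the number of factors is unbounded and
  the element is not a product of commutators in the limit.
\<close>

section \<open>Ultrafilters\<close>

text \<open>An ultrafilter is treated as a minimal proper filter, so that the type of filters and its
  complete lattice structure can be used; in Zorn's lemma the order is therefore reversed.\<close>

lemma exists_ultrafilter_below:
  fixes F :: "'a filter"
  assumes "F \<noteq> bot"
  obtains U where "U \<le> F" "U \<noteq> bot" "\<And>P. eventually P U \<or> eventually (\<lambda>x. \<not> P x) U"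
proof -
  define A where "A = {E. E \<le> F \<and> E \<noteq> bot}"
  have "\<exists>U\<in>A. \<forall>E\<in>A. E \<le> U \<longrightarrow> E = U"
  proof (rule predicate_Zorn)
    show "partial_order_on A (relation_of (\<lambda>x y. y \<le> x) A)"
      by (rule partial_order_on_relation_ofI) auto
    fix C assume "C \<in> Chains (relation_of (\<lambda>x y. y \<le> x) A)"
    then have C: "C \<subseteq> A" "\<And>x y. x \<in> C \<Longrightarrow> y \<in> C \<Longrightarrow> x \<le> y \<or> y \<le> x"
      by (auto simp: Chains_def relation_of_def)
    define D where "D = insert F C"
    have D: "D \<subseteq> A" "\<And>x y. x \<in> D \<Longrightarrow> y \<in> D \<Longrightarrow> x \<le> y \<or> y \<le> x"
      using C assms unfolding D_def A_def by auto
    have "Inf Y \<in> Y" if "finite Y" "Y \<noteq> {}" "Y \<subseteq> D" for Y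
      using that
    proof (induction rule: finite_ne_induct)
      case (insert E Y)
      then have "E \<le> Inf Y \<or> Inf Y \<le> E"
        using D(2) by blast
      then show ?case
        using insert by (auto simp: inf_absorb1 inf_absorb2)
    qed simp
    then have fin: "Inf Y \<noteq> bot" if "finite Y" "Y \<subseteq> D" for Y
    proof (cases "Y = {}")
      case True
      moreover have "(Orderings.top :: 'a filter) \<noteq> bot"
        using assms bot_unique top_greatest by metis
      ultimately show ?thesis by simp
    next
      case False
      then have "Inf Y \<in> A" using \<open>\<And>Y. \<lbrakk>finite Y; Y \<noteq> {}; Y \<subseteq> D\<rbrakk> \<Longrightarrow> Inf Y \<in> Y\<close>[of Y] that D(1) by auto
      then show ?thesis by (simp add: A_def)
    qed
    have "Inf D \<noteq> bot"
      by (rule Inf_filter_not_bot) (rule fin)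
    moreover have "Inf D \<le> E" if "E \<in> D" for E using that by (rule Inf_lower)
    ultimately have "Inf D \<in> A" "\<forall>E\<in>C. Inf D \<le> E"
      unfolding A_def D_def by auto
    then show "\<exists>U\<in>A. \<forall>E\<in>C. U \<le> E" by (rule bexI[rotated])
  qed
  then obtain U where U: "U \<le> F" "U \<noteq> bot" "\<And>E. E \<le> F \<Longrightarrow> E \<noteq> bot \<Longrightarrow> E \<le> U \<Longrightarrow> E = U"
    by (auto simp: A_def)
  have "eventually P U \<or> eventually (\<lambda>x. \<not> P x) U" for P
  proof (cases "inf U (principal {x. P x}) = bot")
    case True
    then have "eventually (\<lambda>x. False) (inf U (principal {x. P x}))" by simp
    then show ?thesis by (simp add: eventually_inf_principal)
  next
    case False
    then have "inf U (principal {x. P x}) = U"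
      using U(1) by (intro U(3)) (auto intro: le_infI1)
    then have "U \<le> principal {x. P x}" by (simp add: inf.absorb_iff1)
    then show ?thesis by (simp add: le_principal)
  qed
  with U show ?thesis using that by blast
qed

lemma ultrafilter_constant_on_finite:
  assumes "U \<noteq> bot" "\<And>P. eventually P U \<or> eventually (\<lambda>x. \<not> P x) U"
    and "finite A" "eventually (\<lambda>x. h x \<in> A) U"
  shows "\<exists>a\<in>A. eventually (\<lambda>x. h x = a) U"
proof (rule ccontr)
  assume "\<not> ?thesis"
  then have "\<forall>a\<in>A. eventually (\<lambda>x. h x \<noteq> a) U"
    using assms(2) by blast
  then have "eventually (\<lambda>x. \<forall>a\<in>A. h x \<noteq> a) U"
    using assms(3) by (simp add: eventually_ball_finite_distrib)
  with assms(4) have "eventually (\<lambda>x. False) U"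
    by eventually_elim auto
  with assms(1) show False by simp
qed

text \<open>The pigeonhole principle gives the finite intersection property for the sets of pairs \<open>i < j\<close> on which
  a sequence in a finite set takes the same value.\<close>

lemma exists_coincidence_ultrafilter:
  assumes "finite S" "S \<noteq> {}"
  obtains U :: "(nat \<times> nat) filter" where "U \<noteq> bot"
    "\<And>P. eventually P U \<or> eventually (\<lambda>x. \<not> P x) U"
    "eventually (\<lambda>(i, j). i < j) U"
    "\<And>q. (\<And>i. q i \<in> S) \<Longrightarrow> eventually (\<lambda>(i, j). q i = q j) U"
proof -
  define E where "E q = {(i::nat, j). i < j \<and> q i = (q j :: 'a)}" for q
  have "(INF q\<in>{q. range q \<subseteq> S}. principal (E q)) \<noteq> bot"
  proof (rule INF_filter_not_bot)
    fix Y :: "(nat \<Rightarrow> 'a) set" assume Y: "Y \<subseteq> {q. range q \<subseteq> S}" "finite Y"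
    then have qS: "q i \<in> S" if "q \<in> Y" for q i using that by auto
    then have "(\<lambda>i. restrict (\<lambda>q. q i) Y) ` UNIV \<subseteq> Y \<rightarrow>\<^sub>E S"
      by auto
    then have "finite ((\<lambda>i. restrict (\<lambda>q. q i) Y) ` UNIV)"
      by (rule finite_subset) (intro finite_PiE Y(2) assms)
    \<comment> \<open>All sequences in \<open>Y\<close> are treated as one sequence with values in a finite set.\<close>
    from pigeonhole_infinite[OF infinite_UNIV_nat this]
    obtain k where k: "infinite {i. restrict (\<lambda>q. q i) Y = restrict (\<lambda>q. q k) Y}"
      by auto
    define M where "M = {i. restrict (\<lambda>q. q i) Y = restrict (\<lambda>q. q k) Y}"
    have inf: "infinite M" using k by (simp add: M_def)
    then obtain i where "i \<in> M" by (auto dest: infinite_imp_nonempty)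
    moreover obtain j where "j \<in> M" "i < j"
      using inf by (auto simp: infinite_nat_iff_unbounded)
    moreover have "q i = q j" if "q \<in> Y" for q
      using calculation that unfolding M_def by (auto dest!: fun_cong[of _ _ q])
    ultimately have "(i, j) \<in> (\<Inter>q\<in>Y. E q)"
      unfolding E_def by auto
    then show "(INF q\<in>Y. principal (E q)) \<noteq> bot"
      using INF_principal_finite[OF Y(2), of E] by (auto simp: principal_eq_bot_iff)
  qed
  then obtain U where U: "U \<le> (INF q\<in>{q. range q \<subseteq> S}. principal (E q))" "U \<noteq> bot"
    "\<And>P. eventually P U \<or> eventually (\<lambda>x. \<not> P x) U"
    by (rule exists_ultrafilter_below) blast
  have ev: "eventually (\<lambda>p. p \<in> E q) U" if "range q \<subseteq> S" for q
    using U(1) that by (auto simp: le_INF_iff le_principal)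
  obtain s where s: "s \<in> S" using assms(2) by blast
  show thesis
  proof (rule that[OF U(2,3)])
    have "eventually (\<lambda>p. p \<in> E (\<lambda>i. s)) U"
      by (rule ev) (use s in auto)
    then show "eventually (\<lambda>(i, j). i < j) U"
      by eventually_elim (auto simp: E_def)
    fix q :: "nat \<Rightarrow> 'a" assume "\<And>i. q i \<in> S"
    then have "eventually (\<lambda>p. p \<in> E q) U"
      by (intro ev) auto
    then show "eventually (\<lambda>(i, j). q i = q j) U"
      by eventually_elim (auto simp: E_def)
  qed
qed

section \<open>Perfect groups\<close>

lemma perfect_group_hom_image:
  assumes "perfect_group S" "group G" "c \<in> hom S G"
  shows "derived G (c ` carrier S) = c ` carrier S"
  using assms group_hom.derived_img[of S G c "carrier S"]
  by (simp add: perfect_group_def group_hom_def group_hom_axioms_def)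

lemma perfect_subgroupI:
  assumes "group G" "subgroup K G" "derived G K = K"
  shows "perfect_group (G\<lparr>carrier := K\<rparr>)"
  using assms group.derived_consistent[of G K K] group.subgroup_imp_group
  by (auto simp: perfect_group_def)

text \<open>Taking all homomorphisms at once makes the subgroup closed under conjugation, and so it contains
  the commutators of its elements with arbitrary elements of \<open>W\<close>.\<close>

definition generated_by_images where
  "generated_by_images S W = generate W (\<Union>c\<in>hom S W. c ` carrier S)"

lemma generated_by_images_subgroup:
  assumes "group W" shows "subgroup (generated_by_images S W) W"
  unfolding generated_by_images_def
  by (rule group.generate_is_subgroup[OF assms]) (auto simp: hom_def)

text \<open>The derived subgroup contains each of the generating images, because these are perfect.\<close>

lemma generated_by_images_perfect:
  assumes "group W" "perfect_group S"
  shows "derived W (generated_by_images S W) = generated_by_images S W"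
proof -
  interpret W: group W by fact
  let ?K = "generated_by_images S W"
  have K: "subgroup ?K W" by (rule generated_by_images_subgroup[OF assms(1)])
  have "c ` carrier S \<subseteq> derived W ?K" if "c \<in> hom S W" for c
  proof -
    have "c ` carrier S \<subseteq> ?K"
      unfolding generated_by_images_def using that by (auto intro: generate.incl)
    from W.mono_derived[OF this] show ?thesis
      by (simp add: perfect_group_hom_image[OF assms(2,1) that])
  qed
  moreover have "subgroup (derived W ?K) W"
    using W.derived_is_subgroup K subgroup.subset by blast
  ultimately have "?K \<subseteq> derived W ?K"
    unfolding generated_by_images_def by (intro W.generate_subgroup_incl) auto
  moreover have "derived W ?K \<subseteq> ?K" using W.derived_incl K by blast
  ultimately show ?thesis by blast
qed

lemma (in group) hom_conjugate:
  assumes "c \<in> hom S G" "d \<in> carrier G"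
  shows "(\<lambda>s. d \<otimes> c s \<otimes> inv d) \<in> hom S G"
proof (rule homI)
  fix x y assume xy: "x \<in> carrier S" "y \<in> carrier S"
  have c: "c x \<in> carrier G" "c y \<in> carrier G"
    using hom_in_carrier[OF assms(1)] xy by auto
  have "inv d \<otimes> (d \<otimes> (c y \<otimes> inv d)) = c y \<otimes> inv d"
    using c assms(2) by (simp flip: m_assoc)
  then show "d \<otimes> c (x \<otimes>\<^bsub>S\<^esub> y) \<otimes> inv d = d \<otimes> c x \<otimes> inv d \<otimes> (d \<otimes> c y \<otimes> inv d)"
    using c assms(2) hom_mult[OF assms(1) xy] by (simp add: m_assoc)
qed (use assms hom_in_carrier in fastforce)

section \<open>The twisted wreath product\<close>

text \<open>The right action of sequences in \<open>S\<close> on triples: left and right multiplication on \<open>S\<close> by the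
  coordinates \<open>i\<close> and \<open>j\<close>.\<close>

definition twist where
  "twist S x q = (case x of (i::nat, j::nat, s) \<Rightarrow> (i, j, inv\<^bsub>S\<^esub> (q i) \<otimes>\<^bsub>S\<^esub> s \<otimes>\<^bsub>S\<^esub> q j))"

type_synonym ('s, 'g) wreath_elem = "(nat \<times> nat \<times> 's \<Rightarrow> 'g) \<times> (nat \<Rightarrow> 's)"

text \<open>The function component is \<open>\<one>\<close> at triples whose last entry lies outside \<open>S\<close>. This makes it
  determined by its values on \<open>S\<close>, so that restriction to finitely many coordinates leaves only
  finitely many elements. The multiplication has to test for \<open>S\<close>, since nothing is known about
  the action on other triples.\<close>

definition twisted_wreath :: "('s, 'k) monoid_scheme \<Rightarrow> ('g, 'm) monoid_scheme
    \<Rightarrow> ('s, 'g) wreath_elem monoid" where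
  "twisted_wreath S G =
    \<lparr>carrier = {(f, q). (\<forall>x. f x \<in> carrier G) \<and> 
         (\<forall>i j s. s \<notin> carrier S \<longrightarrow> f (i, j, s) = \<one>\<^bsub>G\<^esub>) \<and> (\<forall>i. q i \<in> carrier S)},
     monoid.mult = (\<lambda>(f, q) (f', q').
       ((\<lambda>x. if snd (snd x) \<in> carrier S then f x \<otimes>\<^bsub>G\<^esub> f' (twist S x q) else \<one>\<^bsub>G\<^esub>),
        (\<lambda>i. q i \<otimes>\<^bsub>S\<^esub> q' i))),
     one = ((\<lambda>x. \<one>\<^bsub>G\<^esub>), (\<lambda>i. \<one>\<^bsub>S\<^esub>))\<rparr>"

text \<open>Elements restricted to \<open>J\<close> stay in the same group and are trivial off \<open>J\<close>. The finite levels are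
  thus subgroups of a single group, and a transition map is given by an endomorphism that depends on its
  target level only.\<close>

definition restrict_coords :: "('s, 'k) monoid_scheme \<Rightarrow> ('g, 'm) monoid_scheme \<Rightarrow> nat set
    \<Rightarrow> ('s, 'g) wreath_elem \<Rightarrow> ('s, 'g) wreath_elem" where
  "restrict_coords S G J = (\<lambda>(f, q). (\<lambda>(i, j, s). if i \<in> J \<and> j \<in> J then f (i, j, s) else \<one>\<^bsub>G\<^esub>,
                  \<lambda>i. if i \<in> J then q i else \<one>\<^bsub>S\<^esub>))"

locale two_groups = G: group G + S: group S
  for G :: "('g, 'm) monoid_scheme" and S :: "('s, 'k) monoid_scheme"
begin

abbreviation W where "W \<equiv> twisted_wreath S G"

lemma W_carrier: "(f, q) \<in> carrier W \<longleftrightarrow> (\<forall>x. f x \<in> carrier G) \<and> 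
   (\<forall>i j s. s \<notin> carrier S \<longrightarrow> f (i, j, s) = \<one>\<^bsub>G\<^esub>) \<and> (\<forall>i. q i \<in> carrier S)"
  by (auto simp: twisted_wreath_def)

lemma W_one: "\<one>\<^bsub>W\<^esub> = (\<lambda>x. \<one>\<^bsub>G\<^esub>, \<lambda>i. \<one>\<^bsub>S\<^esub>)"
  by (simp add: twisted_wreath_def)

lemma W_mult: "(f, q) \<otimes>\<^bsub>W\<^esub> (f', q') = (\<lambda>(i, j, s). if s \<in> carrier S
     then f (i, j, s) \<otimes>\<^bsub>G\<^esub> f' (i, j, inv\<^bsub>S\<^esub> (q i) \<otimes>\<^bsub>S\<^esub> s \<otimes>\<^bsub>S\<^esub> q j) else \<one>\<^bsub>G\<^esub>,
      \<lambda>i. q i \<otimes>\<^bsub>S\<^esub> q' i)"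
  by (auto simp: twisted_wreath_def twist_def fun_eq_iff)

lemma W_group: "group W"
proof (rule groupI)
  fix u v assume "u \<in> carrier W" "v \<in> carrier W"
  then show "u \<otimes>\<^bsub>W\<^esub> v \<in> carrier W"
    by (cases u; cases v) (auto simp: W_mult W_carrier)
next
  show "\<one>\<^bsub>W\<^esub> \<in> carrier W" by (simp add: W_one W_carrier)
next
  fix u v w assume "u \<in> carrier W" "v \<in> carrier W" "w \<in> carrier W"
  then show "u \<otimes>\<^bsub>W\<^esub> v \<otimes>\<^bsub>W\<^esub> w = u \<otimes>\<^bsub>W\<^esub> (v \<otimes>\<^bsub>W\<^esub> w)"
    by (cases u; cases v; cases w)
      (auto simp: W_mult W_carrier fun_eq_iff G.m_assoc S.m_assoc S.inv_mult_group)
next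
  fix u assume "u \<in> carrier W"
  then show "\<one>\<^bsub>W\<^esub> \<otimes>\<^bsub>W\<^esub> u = u"
    by (cases u) (auto simp: W_mult W_one W_carrier fun_eq_iff)
next
  fix u assume u: "u \<in> carrier W"
  obtain f q where fq: "u = (f, q)" by fastforce
  let ?f = "\<lambda>(i, j, s). if s \<in> carrier S then
     inv\<^bsub>G\<^esub> (f (i, j, q i \<otimes>\<^bsub>S\<^esub> s \<otimes>\<^bsub>S\<^esub> inv\<^bsub>S\<^esub> (q j))) else \<one>\<^bsub>G\<^esub>"
  have "(?f, \<lambda>i. inv\<^bsub>S\<^esub> (q i)) \<in> carrier W" "(?f, \<lambda>i. inv\<^bsub>S\<^esub> (q i)) \<otimes>\<^bsub>W\<^esub> u = \<one>\<^bsub>W\<^esub>"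
    using u by (auto simp: fq W_mult W_one W_carrier fun_eq_iff)
  then show "\<exists>v\<in>carrier W. v \<otimes>\<^bsub>W\<^esub> u = \<one>\<^bsub>W\<^esub>" by blast
qed

lemma restrict_coords_apply: "restrict_coords S G J (f, q) = (\<lambda>(i, j, s). if i \<in> J \<and> j \<in> J then f (i, j, s) else \<one>\<^bsub>G\<^esub>,
                  \<lambda>i. if i \<in> J then q i else \<one>\<^bsub>S\<^esub>)"
  by (simp add: restrict_coords_def)

text \<open>Restriction is compatible with multiplication because the action preserves \<open>i\<close> and \<open>j\<close> and only
  involves the coordinates \<open>i\<close> and \<open>j\<close> of the acting sequence.\<close>

lemma restrict_coords_hom: "restrict_coords S G J \<in> hom W W"
proof (rule homI)
  fix u assume "u \<in> carrier W"
  then show "restrict_coords S G J u \<in> carrier W"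
    by (cases u) (auto simp: W_carrier restrict_coords_apply)
next
  fix u v assume "u \<in> carrier W" "v \<in> carrier W"
  then show "restrict_coords S G J (u \<otimes>\<^bsub>W\<^esub> v) = restrict_coords S G J u \<otimes>\<^bsub>W\<^esub> restrict_coords S G J v"
    by (cases u; cases v) (auto simp: W_mult W_carrier restrict_coords_apply fun_eq_iff)
qed

lemma restrict_coords_restrict_coords: "J \<subseteq> J' \<Longrightarrow> restrict_coords S G J (restrict_coords S G J' u) = restrict_coords S G J u"
  by (cases u) (auto simp: restrict_coords_apply fun_eq_iff)

lemma finite_restrict_coords_image:
  assumes "finite J" "finite (carrier G)" "finite (carrier S)"
  shows "finite (restrict_coords S G J ` carrier W)"
proof (rule finite_subset)
  let ?A = "{f. \<forall>x. (x \<in> J \<times> J \<times> carrier S \<longrightarrow> f x \<in> carrier G) \<and> (x \<notin> J \<times> J \<times> carrier S \<longrightarrow> f x = \<one>\<^bsub>G\<^esub>)}"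
  let ?B = "{q. \<forall>x. (x \<in> J \<longrightarrow> q x \<in> carrier S) \<and> (x \<notin> J \<longrightarrow> q x = \<one>\<^bsub>S\<^esub>)}"
  show "restrict_coords S G J ` carrier W \<subseteq> ?A \<times> ?B"
    by (auto simp: restrict_coords_apply W_carrier)
  show "finite (?A \<times> ?B)"
    using assms by (intro finite_cartesian_product finite_set_of_finite_funs) auto
qed

text \<open>The elements whose ultralimit will be \<open>a\<close>. Without the second value \<open>inv a\<close>, the product of
  the values over \<open>s\<close> would be \<open>a\<close>; modulo commutators of \<open>G\<close> this product is a homomorphism on \<open>W\<close>,
  so the element could not lie in a perfect subgroup unless \<open>a\<close> is in the derived subgroup of \<open>G\<close>. Pairs with \<open>i = j\<close> are left out because the action fixes \<open>(i, i, \<one>)\<close>.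
  The parameter \<open>M\<close> restricts \<open>i\<close> only, so that one commutator handles all \<open>j\<close> at once.\<close>

definition marker :: "'s \<Rightarrow> 'g \<Rightarrow> nat set \<Rightarrow> ('s, 'g) wreath_elem" where
  "marker t a M = (\<lambda>(i, j, s). if i \<in> M \<and> i < j \<and> s = \<one>\<^bsub>S\<^esub> then a
       else if i \<in> M \<and> i < j \<and> s = t then inv\<^bsub>G\<^esub> a else \<one>\<^bsub>G\<^esub>, \<lambda>i. \<one>\<^bsub>S\<^esub>)"

lemma marker_carrier: "a \<in> carrier G \<Longrightarrow> t \<in> carrier S \<Longrightarrow> marker t a M \<in> carrier W"
  by (auto simp: marker_def W_carrier)

text \<open>Each coordinate \<open>k\<close> contributes a commutator of a function \<open>d\<close> supported on the triples
  \<open>(k, j, \<one>)\<close> with \<open>j > k\<close> and the element \<open>c\<close> of the copy of \<open>S\<close> at \<open>k\<close> with value \<open>t\<close>: the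
  conjugate of the inverse of \<open>d\<close> by \<open>c\<close> is supported on the triples \<open>(k, j, t)\<close>. Both \<open>d c d\<inverse>\<close> and
  \<open>c\<inverse>\<close> lie in homomorphic images of \<open>S\<close>.\<close>

lemma marker_mem:
  assumes "a \<in> carrier G" "t \<in> carrier S" "t \<noteq> \<one>\<^bsub>S\<^esub>" "finite M"
  shows "marker t a M \<in> generated_by_images S W"
  using assms(4)
proof induction
  interpret W: group W by (rule W_group)
  have K: "subgroup (generated_by_images S W) W"
    by (rule generated_by_images_subgroup[OF W_group])
  {
    case empty
    have "marker t a {} = \<one>\<^bsub>W\<^esub>" by (auto simp: marker_def W_one)
    then show ?case using subgroup.one_closed[OF K] by simp
  next
    case (insert k M)
    let ?d = "(\<lambda>(i, j, s). if i = k \<and> i < j \<and> s = \<one>\<^bsub>S\<^esub> then a else \<one>\<^bsub>G\<^esub>, \<lambda>i. \<one>\<^bsub>S\<^esub>)"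
    let ?c = "\<lambda>s::'s. (\<lambda>x::nat \<times> nat \<times> 's. \<one>\<^bsub>G\<^esub>, \<lambda>i. if i = k then s else \<one>\<^bsub>S\<^esub>)"
    have d: "?d \<in> carrier W" using assms by (auto simp: W_carrier)
    have c: "?c \<in> hom S W"
      by (rule homI) (auto simp: W_carrier W_mult fun_eq_iff)
    have ct: "?c t \<in> carrier W" using c assms(2) by (rule hom_in_carrier)
    have cd: "(\<lambda>s. ?d \<otimes>\<^bsub>W\<^esub> ?c s \<otimes>\<^bsub>W\<^esub> inv\<^bsub>W\<^esub> ?d) \<in> hom S W"
      using c d by (rule W.hom_conjugate)
    have mem: "h t \<in> generated_by_images S W" if "h \<in> hom S W" for h
      unfolding generated_by_images_def using that assms(2) by (blast intro: generate.incl)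
    have t_cancel: "inv\<^bsub>S\<^esub> t \<otimes>\<^bsub>S\<^esub> s = \<one>\<^bsub>S\<^esub> \<longleftrightarrow> s = t" if "s \<in> carrier S" for s
      using that assms(2) S.inv_solve_left[of "\<one>\<^bsub>S\<^esub>" t s] by auto
    \<comment> \<open>This is the commutator relation of \<open>d\<close> and \<open>c\<close>, cleared of inverses.\<close>
    have "marker t a (insert k M) \<otimes>\<^bsub>W\<^esub> (?c t \<otimes>\<^bsub>W\<^esub> ?d) = marker t a M \<otimes>\<^bsub>W\<^esub> (?d \<otimes>\<^bsub>W\<^esub> ?c t)"
      using assms insert.hyps t_cancel by (auto simp: marker_def W_mult fun_eq_iff)
    then have "marker t a (insert k M)
        = marker t a M \<otimes>\<^bsub>W\<^esub> (?d \<otimes>\<^bsub>W\<^esub> ?c t) \<otimes>\<^bsub>W\<^esub> inv\<^bsub>W\<^esub> (?c t \<otimes>\<^bsub>W\<^esub> ?d)"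
      by (subst W.inv_solve_right) (intro marker_carrier assms W.m_closed d ct refl | simp)+
    also have "\<dots> = marker t a M \<otimes>\<^bsub>W\<^esub> (?d \<otimes>\<^bsub>W\<^esub> ?c t \<otimes>\<^bsub>W\<^esub> inv\<^bsub>W\<^esub> ?d) \<otimes>\<^bsub>W\<^esub> inv\<^bsub>W\<^esub> (?c t)"
      using marker_carrier[OF assms(1,2), of M] d ct by (simp only: W.inv_mult_group W.m_assoc W.m_closed W.inv_closed)
    finally show ?case
      using mem[OF c] mem[OF cd] insert.IH K by (simp add: subgroup.m_closed subgroup.m_inv_closed)
  }
qed

section \<open>The inverse system and its limit\<close>

abbreviation finite_level where
  "finite_level J \<equiv> W\<lparr>carrier := restrict_coords S G J ` generated_by_images S W\<rparr>"

lemma restrict_coords_image_subgroup: "subgroup (restrict_coords S G J ` generated_by_images S W) W"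
  using group_hom.subgroup_img_is_subgroup[of W W "restrict_coords S G J"] W_group restrict_coords_hom
    generated_by_images_subgroup[OF W_group, where S = S]
  by (simp add: group_hom_def group_hom_axioms_def)

lemma finite_level_group: "group (finite_level J)"
  by (rule group.subgroup_imp_group[OF W_group restrict_coords_image_subgroup])

lemma finite_level_perfect:
  assumes "perfect_group S" shows "perfect_group (finite_level J)"
proof (rule perfect_subgroupI[OF W_group restrict_coords_image_subgroup])
  have "derived W (restrict_coords S G J ` generated_by_images S W) = restrict_coords S G J ` derived W (generated_by_images S W)"
    using group_hom.derived_img[of W W "restrict_coords S G J"] W_group restrict_coords_hom
      subgroup.subset[OF generated_by_images_subgroup[OF W_group, where S = S]]
    by (simp add: group_hom_def group_hom_axioms_def)
  then show "derived W (restrict_coords S G J ` generated_by_images S W) = restrict_coords S G J ` generated_by_images S W"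
    by (simp add: generated_by_images_perfect[OF W_group assms])
qed

lemma finite_level_finite:
  assumes "finite J" "finite (carrier G)" "finite (carrier S)"
  shows "finite (carrier (finite_level J))"
  using finite_subset[OF image_mono finite_restrict_coords_image[OF assms]]
    subgroup.subset[OF generated_by_images_subgroup[OF W_group, where S = S]] by simp

abbreviation (input) "levels \<equiv> {J :: nat set. finite J}"
abbreviation (input) "level_order \<equiv> {(J :: nat set, J'). finite J' \<and> J \<subseteq> J'}"

lemma finite_level_surj:
  assumes "J \<subseteq> J'"
  shows "restrict_coords S G J ` carrier (finite_level J') = carrier (finite_level J)"
  using assms by (simp add: image_image restrict_coords_restrict_coords)

lemma finite_level_system:
  "group_inverse_system levels level_order finite_level (\<lambda>J J'. restrict_coords S G J)"
proof (rule group_inverse_system.intro)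
  show "directed_set levels level_order"
    unfolding directed_set_def partial_order_on_def preorder_on_def
    by (auto simp: refl_on_def trans_def antisym_def intro: finite_subset exI[of _ "_ \<union> _"])
next
  fix J assume "J \<in> levels"
  show "group (finite_level J)" by (rule finite_level_group)
next
  fix J J' assume J: "(J, J') \<in> level_order"
  show "restrict_coords S G J \<in> hom (finite_level J') (finite_level J)"
  proof (rule homI)
    fix x y assume "x \<in> carrier (finite_level J')" "y \<in> carrier (finite_level J')"
    then have "x \<in> carrier W" "y \<in> carrier W"
      using subgroup.subset[OF restrict_coords_image_subgroup] by auto
    then show "restrict_coords S G J (x \<otimes>\<^bsub>finite_level J'\<^esub> y) = restrict_coords S G J x \<otimes>\<^bsub>finite_level J\<^esub> restrict_coords S G J y"
      using hom_mult[OF restrict_coords_hom] by simp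
  qed (use finite_level_surj J in blast)
next
  fix J x assume "x \<in> carrier (finite_level J)"
  then show "restrict_coords S G J x = x" by (auto simp: restrict_coords_restrict_coords)
next
  fix J J' J'' x assume "(J, J') \<in> level_order"
  then show "restrict_coords S G J (restrict_coords S G J' x) = restrict_coords S G J x" by (simp add: restrict_coords_restrict_coords)
qed

text \<open>An element of the limit is evaluated at \<open>(i, j, \<one>)\<close> through its component at the level
  \<open>{i, j}\<close>. This evaluation is multiplicative on two given elements \<open>x\<close>, \<open>y\<close> as soon as the acting
  sequence \<open>q\<close> of \<open>x\<close> satisfies \<open>q i = q j\<close>, which holds along the ultrafilter; as \<open>G\<close> is finite, the
  evaluations are eventually constant.\<close>

lemma finite_level_limit_epi:
  assumes "finite (carrier G)" "finite (carrier S)" "t \<in> carrier S" "t \<noteq> \<one>\<^bsub>S\<^esub>"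
  obtains \<phi> where "\<phi> \<in> epi (inverse_limit levels level_order finite_level (\<lambda>J J'. restrict_coords S G J)) G"
proof -
  let ?P = "inverse_limit levels level_order finite_level (\<lambda>J J'. restrict_coords S G J)"
  have "carrier S \<noteq> {}" using assms(3) by blast
  then obtain U :: "(nat \<times> nat) filter" where U: "U \<noteq> bot"
    "\<And>P. eventually P U \<or> eventually (\<lambda>x. \<not> P x) U"
    "eventually (\<lambda>(i, j). i < j) U"
    "\<And>q. (\<And>i. q i \<in> carrier S) \<Longrightarrow> eventually (\<lambda>(i, j). q i = q j) U"
    using exists_coincidence_ultrafilter[OF assms(2)] by blast
  have level: "x J \<in> carrier W" if "x \<in> carrier ?P" "finite J" for x J
    using that subgroup.subset[OF restrict_coords_image_subgroup]
    by (fastforce simp: inverse_limit_def PiE_iff)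
  have compat: "restrict_coords S G J (x J') = x J" if "x \<in> carrier ?P" "finite J'" "J \<subseteq> J'" for x J J'
    using that by (auto simp: inverse_limit_def)
  have mult: "(x \<otimes>\<^bsub>?P\<^esub> y) J = x J \<otimes>\<^bsub>W\<^esub> y J" if "finite J" for x y J
    using that by (simp add: inverse_limit_def)
  define ev where "ev x p = (case p of (i, j) \<Rightarrow> fst (x {i, j}) (i, j, \<one>\<^bsub>S\<^esub>))"
    for x :: "nat set \<Rightarrow> ('s, 'g) wreath_elem" and p :: "nat \<times> nat"
  define \<phi> where "\<phi> x = (SOME a. a \<in> carrier G \<and> eventually (\<lambda>p. ev x p = a) U)" for x
  have ev_carrier: "ev x p \<in> carrier G" if "x \<in> carrier ?P" for x p
    using level[OF that, of "{fst p, snd p}"] by (cases "x {fst p, snd p}") (auto simp: ev_def W_carrier split: prod.split)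
  have \<phi>: "\<phi> x \<in> carrier G \<and> eventually (\<lambda>p. ev x p = \<phi> x) U" if "x \<in> carrier ?P" for x
    unfolding \<phi>_def 
  proof (rule someI_ex)
    show "\<exists>a. a \<in> carrier G \<and> eventually (\<lambda>p. ev x p = a) U"
      using ultrafilter_constant_on_finite[OF U(1,2) assms(1), of "ev x"] ev_carrier[OF that]
      by auto
  qed
  have \<phi>_eqI: "\<phi> x = a" if "x \<in> carrier ?P" "eventually (\<lambda>p. ev x p = a) U" for x a
  proof -
    have "eventually (\<lambda>p. \<phi> x = a) U"
      using \<phi>[OF that(1), THEN conjunct2] that(2) by eventually_elim auto
    then show ?thesis using U(1) by (simp add: eventually_const)
  qed
  interpret P: group ?P
    using group_inverse_system.group_inverse_limit[OF finite_level_system] .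
  have "\<phi> \<in> hom ?P G"
  proof (rule homI)
    fix x y assume x: "x \<in> carrier ?P" and y: "y \<in> carrier ?P"
    \<comment> \<open>The components of \<open>x\<close> at the singletons assemble to one sequence in \<open>S\<close>.\<close>
    define q where "q i = snd (x {i}) i" for i
    have q: "q i \<in> carrier S" for i
      using level[OF x, of "{i}"] by (cases "x {i}") (auto simp: q_def W_carrier)
    have coord: "snd (x {i, j}) i = q i" "snd (x {i, j}) j = q j" for i j
    proof -
      have "snd (x {i}) i = snd (restrict_coords S G {i} (x {i, j})) i"
        "snd (x {j}) j = snd (restrict_coords S G {j} (x {i, j})) j"
        using compat[OF x, of "{i, j}"] by simp_all
      then show "snd (x {i, j}) i = q i" "snd (x {i, j}) j = q j"
        by (simp_all add: q_def restrict_coords_def split_beta)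
    qed
    have "ev (x \<otimes>\<^bsub>?P\<^esub> y) (i, j) = ev x (i, j) \<otimes>\<^bsub>G\<^esub> ev y (i, j)" if "q i = q j" for i j
      using coord[where i=i and j=j] q[of j] that unfolding ev_def
      by (cases "x {i, j}"; cases "y {i, j}") (simp add: mult W_mult)
    with U(4)[of q, OF q] have "eventually (\<lambda>p. ev (x \<otimes>\<^bsub>?P\<^esub> y) p = ev x p \<otimes>\<^bsub>G\<^esub> ev y p) U"
      by (auto elim!: eventually_mono)
    then have "eventually (\<lambda>p. ev (x \<otimes>\<^bsub>?P\<^esub> y) p = \<phi> x \<otimes>\<^bsub>G\<^esub> \<phi> y) U"
      using \<phi>[OF x, THEN conjunct2] \<phi>[OF y, THEN conjunct2] by eventually_elim simp
    then show "\<phi> (x \<otimes>\<^bsub>?P\<^esub> y) = \<phi> x \<otimes>\<^bsub>G\<^esub> \<phi> y"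
      using P.m_closed[OF x y] by (intro \<phi>_eqI)
  qed (use \<phi> in blast)
  moreover have "a \<in> \<phi> ` carrier ?P" if a: "a \<in> carrier G" for a
  proof -
    \<comment> \<open>The full marker need not lie in the perfect subgroup, but each of its restrictions does:
      on the level \<open>J\<close> it agrees with the marker for the finite set \<open>J\<close>.\<close>
    define x where "x = restrict (\<lambda>J. restrict_coords S G J (marker t a UNIV)) levels"
    have "restrict_coords S G J (marker t a UNIV) = restrict_coords S G J (marker t a J)" for J
      by (auto simp: marker_def restrict_coords_apply fun_eq_iff)
    then have "restrict_coords S G J (marker t a UNIV) \<in> restrict_coords S G J ` generated_by_images S W" if "finite J" for J
      using marker_mem[OF a assms(3,4) that] by simp
    then have x: "x \<in> carrier ?P"
      by (auto simp: inverse_limit_def x_def restrict_coords_restrict_coords intro: finite_subset)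
    have "ev x (i, j) = a" if "i < j" for i j
      using that by (simp add: ev_def x_def marker_def restrict_coords_apply)
    then have "eventually (\<lambda>p. ev x p = a) U"
      using U(3) by (auto elim!: eventually_mono)
    then show ?thesis using \<phi>_eqI[OF x] x by blast
  qed
  ultimately show thesis
    using that by (auto simp: epi_iff_subset)
qed

end

section \<open>Transport along isomorphisms\<close>

lemma perfect_group_iso:
  assumes "perfect_group G" "group H" "e \<in> iso G H"
  shows "perfect_group H"
  using perfect_group_hom_image[OF assms(1,2), of e] assms(2,3)
  by (auto simp: perfect_group_def iso_def bij_betw_def)

text \<open>This allows the finite groups of an inverse system to be replaced by groups of natural numbers.\<close>

lemma transport_inverse_system:
  fixes e :: "'i \<Rightarrow> 'a \<Rightarrow> 'c"
  assumes sys: "group_inverse_system I r H f"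
    and grp: "\<And>i. i \<in> I \<Longrightarrow> group (H' i)"
    and iso: "\<And>i. i \<in> I \<Longrightarrow> e i \<in> iso (H i) (H' i)"
    and f': "\<And>i j. f' i j = e i \<circ> f i j \<circ> inv_into (carrier (H j)) (e j)"
  shows "group_inverse_system I r H' f'"
    and "(\<lambda>x. \<lambda>i\<in>I. inv_into (carrier (H i)) (e i) (x i))
      \<in> epi (inverse_limit I r H' f') (inverse_limit I r H f)"
proof -
  interpret group_inverse_system I r H f by (rule sys)
  define d where "d i = inv_into (carrier (H i)) (e i)" for i
  have rI: "i \<in> I" "j \<in> I" if "(i, j) \<in> r" for i j
    using directed that by (auto simp: directed_set_def dest: partial_order_onD)
  have d: "d i \<in> hom (H' i) (H i)" if "i \<in> I" for i
    using group.iso_set_sym[OF groups iso] that by (simp add: d_def iso_def)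
  have e: "e i \<in> hom (H i) (H' i)" if "i \<in> I" for i
    using iso[OF that] by (simp add: iso_def)
  have de: "d i (e i x) = x" if "i \<in> I" "x \<in> carrier (H i)" for i x
    using iso[OF that(1)] bij_betw_inv_into_left[OF _ that(2)] by (auto simp: d_def iso_def)
  have ed: "e i (d i x) = x" if "i \<in> I" "x \<in> carrier (H' i)" for i x
    using iso[OF that(1)] bij_betw_inv_into_right[OF _ that(2)] by (auto simp: d_def iso_def)
  have f'_apply: "f' i j x = e i (f i j (d j x))" for i j x
    by (simp add: f' d_def)
  have dc: "d i x \<in> carrier (H i)" if "i \<in> I" "x \<in> carrier (H' i)" for i x
    using hom_in_carrier[OF d] that .
  have ec: "e i x \<in> carrier (H' i)" if "i \<in> I" "x \<in> carrier (H i)" for i x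
    using hom_in_carrier[OF e] that .
  have fc: "f i j x \<in> carrier (H i)" if "(i, j) \<in> r" "x \<in> carrier (H j)" for i j x
    using hom_in_carrier[OF transition_hom] that .
  show "group_inverse_system I r H' f'"
  proof (rule group_inverse_system.intro)
    show "directed_set I r" by (rule directed)
    show "group (H' i)" if "i \<in> I" for i using that by (rule grp)
    show "f' i j \<in> hom (H' j) (H' i)" if "(i, j) \<in> r" for i j
      unfolding f' d_def[symmetric]
      by (intro hom_compose[OF hom_compose[OF d transition_hom] e, simplified comp_assoc[symmetric]] that rI[OF that])
    show "f' i i x = x" if "i \<in> I" "x \<in> carrier (H' i)" for i x
      using that by (simp add: f'_apply transition_id dc ed)
    show "f' i j (f' j k x) = f' i k x" if "(i, j) \<in> r" "(j, k) \<in> r" "x \<in> carrier (H' k)" for i j k x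
      using that rI[OF that(1)] rI[OF that(2)] by (simp add: f'_apply de dc fc transition_comp)
  qed
  show "(\<lambda>x. \<lambda>i\<in>I. inv_into (carrier (H i)) (e i) (x i))
      \<in> epi (inverse_limit I r H' f') (inverse_limit I r H f)"
    unfolding d_def[symmetric]
  proof (rule epi_right_invertible[where f = "\<lambda>x. \<lambda>i\<in>I. e i (x i)"])
    let ?d = "\<lambda>x. \<lambda>i\<in>I. d i (x i)" and ?e = "\<lambda>x. \<lambda>i\<in>I. e i (x i)"
    show "?d \<in> hom (inverse_limit I r H' f') (inverse_limit I r H f)"
    proof (rule homI)
      fix x assume x: "x \<in> carrier (inverse_limit I r H' f')"
      have "f i j (d j (x j)) = d i (x i)" if ij: "(i, j) \<in> r" for i j
      proof -
        have "x j \<in> carrier (H' j)" "e i (f i j (d j (x j))) = x i"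
          using x ij rI[OF ij] by (auto simp: inverse_limit_def PiE_iff f'_apply)
        then show ?thesis using rI[OF ij] de[of i "f i j (d j (x j))"] fc[OF ij] dc by metis
      qed
      then show "?d x \<in> carrier (inverse_limit I r H f)"
        using x rI by (auto simp: inverse_limit_def PiE_iff dc)
      fix y assume y: "y \<in> carrier (inverse_limit I r H' f')"
      show "?d (x \<otimes>\<^bsub>inverse_limit I r H' f'\<^esub> y) = ?d x \<otimes>\<^bsub>inverse_limit I r H f\<^esub> ?d y"
        using x y hom_mult[OF d] by (auto simp: inverse_limit_def PiE_iff fun_eq_iff)
    qed
    show "?e \<in> carrier (inverse_limit I r H f) \<rightarrow> carrier (inverse_limit I r H' f')"
    proof
      fix x assume x: "x \<in> carrier (inverse_limit I r H f)"
      have "f' i j (e j (x j)) = e i (x i)" if ij: "(i, j) \<in> r" for i j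
        using x ij rI[OF ij] by (auto simp: inverse_limit_def PiE_iff f'_apply de)
      then show "?e x \<in> carrier (inverse_limit I r H' f')"
        using x rI by (auto simp: inverse_limit_def PiE_iff ec)
    qed
    show "?d (?e x) = x" if "x \<in> carrier (inverse_limit I r H f)" for x
      using that by (auto simp: inverse_limit_def PiE_iff fun_eq_iff de extensional_def)
  qed
qed

section \<open>Finite groups as quotients of limits of perfect groups\<close>

theorem theorem1p4:
  fixes G :: "('g, 'm) monoid_scheme"
  assumes "group G" and "finite (carrier G)"
  shows "\<exists>(I :: nat set set) r (H :: nat set \<Rightarrow> nat monoid) f.
    group_inverse_system I r H f \<and>
    (\<forall>i\<in>I. finite (carrier (H i)) \<and> perfect_group (H i)) \<and>
    (\<forall>(i, j)\<in>r. f i j ` carrier (H j) = carrier (H i)) \<and>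
    (\<exists>\<phi>. \<phi> \<in> epi (inverse_limit I r H f) G)"
proof -
  let ?S = "alt_group 5"
  have S: "perfect_group ?S"
    using alt_group_is_group derived_alt_group_const[of 5] by (simp add: perfect_group_def)
  have fin_S: "finite (carrier ?S)"
    by (rule finite_subset[OF _ finite_permutations[of "{1..5::nat}"]]) (auto simp: alt_group_carrier)
  have "\<not> carrier ?S \<subseteq> {\<one>\<^bsub>?S\<^esub>}"
  proof
    assume "carrier ?S \<subseteq> {\<one>\<^bsub>?S\<^esub>}"
    then have "card (carrier ?S) \<le> card {\<one>\<^bsub>?S\<^esub>}" by (intro card_mono) simp_all
    moreover have "2 * card (carrier ?S) = fact 5" by (rule alt_group_card_carrier) simp
    ultimately show False by (simp add: fact_numeral)
  qed
  then obtain t where t: "t \<in> carrier ?S" "t \<noteq> \<one>\<^bsub>?S\<^esub>" by blast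
  interpret two_groups G ?S
    using assms(1) alt_group_is_group by (simp add: two_groups_def)
  obtain \<phi> where \<phi>: "\<phi> \<in> epi (inverse_limit levels level_order finite_level (\<lambda>J J'. restrict_coords ?S G J)) G"
    by (rule finite_level_limit_epi[OF assms(2) fin_S t])
  have "\<exists>e :: _ \<Rightarrow> nat. inj_on e (carrier (finite_level J))" if "J \<in> levels" for J
    using finite_level_finite[OF _ assms(2) fin_S, of J] that finite_imp_inj_to_nat_seg by blast
  then obtain e :: "nat set \<Rightarrow> _ \<Rightarrow> nat"
    where e: "\<And>J. J \<in> levels \<Longrightarrow> inj_on (e J) (carrier (finite_level J))"
    by metis
  let ?H = "\<lambda>J. image_group (e J) (finite_level J)"
  let ?f = "\<lambda>J J'. e J \<circ> restrict_coords ?S G J \<circ> inv_into (carrier (finite_level J')) (e J')"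
  have iso: "e J \<in> iso (finite_level J) (?H J)" if "J \<in> levels" for J
    using e[OF that] by (rule inj_imp_image_group_iso)
  have grp: "group (?H J)" if "J \<in> levels" for J
    using group.inj_imp_image_group_is_group[OF finite_level_group e[OF that]] .
  note T = transport_inverse_system[OF finite_level_system grp iso refl]
  show ?thesis
  proof (intro exI conjI ballI)
    show sys: "group_inverse_system levels level_order ?H ?f" by (rule T(1))
    fix J assume J: "J \<in> levels"
    show "finite (carrier (?H J))"
      using finite_level_finite[OF _ assms(2) fin_S, of J] J by (simp add: image_group_carrier)
    show "perfect_group (?H J)"
      using perfect_group_iso[OF finite_level_perfect[OF S] group_inverse_system.groups[OF sys J] iso[OF J]] .
  next
    show "\<phi> \<circ> (\<lambda>x. \<lambda>J\<in>levels. inv_into (carrier (finite_level J)) (e J) (x J))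
       \<in> epi (inverse_limit levels level_order ?H ?f) G"
      by (rule epi_compose[OF T(2) \<phi>])
  next
    fix p assume "p \<in> level_order"
    then obtain J J' where p: "p = (J, J')" "finite J'" "J \<subseteq> J'" by auto
    have "?f J J' ` carrier (?H J') = e J ` restrict_coords ?S G J ` (inv_into (carrier (finite_level J')) (e J') ` e J' ` carrier (finite_level J'))"
      by (simp only: image_group_carrier image_comp comp_assoc)
    also have "\<dots> = carrier (?H J)"
      using e[of J'] p by (simp only: inv_into_image_cancel image_group_carrier finite_level_surj mem_Collect_eq subset_refl)
    finally show "case p of (J, J') \<Rightarrow> ?f J J' ` carrier (?H J') = carrier (?H J)"
      by (simp add: p)
  qed
qed

end
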